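(* Let $d\ge 2$ and let $\rho$ be a density operator on $\mathbb{C}^d\otimes\mathbb{C}^d$ of rank $n$ belonging to the class $\mathcal{D}$. Let $\rho=\sum_{k=1}^n|\phi_k\rangle\langle\phi_k|$ be a decomposition into sub-normalized vectors whose $\tau$-tensor is diagonal with non-negative diagonal entries, i.e. $\tau^{\phi}_{k_1k_2\dots k_d}=\lambda_{k_1}\delta_{k_1k_2}\cdots\delta_{k_1k_d}$ with real $\lambda_k\ge 0$ for $k=1,\dots,n$. Then $$G_a(\rho)=\sum_{k=1}^n\lambda_k^{2/d}.$$
   Context: G-concurrence of a (possibly sub-normalized) vector $|\phi\rangle=\sum_{i,j=1}^d a_{ij}|i\rangle|j\rangle\in\mathbb{C}^d\otimes\mathbb{C}^d$ with $A=(a_{ij})$: $G(|\phi\rangle)=d\,[\mathrm{Det}(A^\dagger A)]^{1/d}$ (so $G(\sqrt p\,|\phi\rangle)=p\,G(|\phi\rangle)$). A decomposition of $\rho$ is a finite family of sub-normalized vectors $|\chi_l\rangle$, $l=1,\dots,m$, with $\rho=\sum_{l=1}^m|\chi_l\rangle\langle\chi_l|$. For a density operator $\rho$ on $\mathbb{C}^d\otimes\mathbb{C}^d$, $G_a(\rho)$ denotes the G-concurrence of assistance of any purification of $\rho$, namely $G_a(\rho)=\max\sum_{l}G(|\chi_l\rangle)$, the maximum over all finite decompositions of $\rho$ into sub-normalized vectors. $\tau$-tensor: fix the product basis $|i\rangle|j\rangle$. For a decomposition $\rho=\sum_{k}|\phi_k\rangle\langle\phi_k|$ write $|\phi_k\rangle=\sum_{i,j=1}^d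 \overline{a_{ij}^{k}}\,|i\rangle|j\rangle$, and set $$\tau^\phi_{k_1\dots k_d}=\frac{d^{d/2}}{d!}\sum_{\sigma\in S_d}\mathrm{Det}\left(a^{k_{\sigma(i)}}_{ij}\right)_{i,j=1}^d ,$$ i.e. row $i$ of the matrix is $(a_{i1}^{k_{\sigma(i)}},\dots,a_{id}^{k_{\sigma(i)}})$. Class $\mathcal{D}$: let $\rho$ have rank $n$ and let $\rho=\sum_{k=1}^n|\phi_k\rangle\langle\phi_k|$ be its eigen-decomposition into orthogonal sub-normalized eigenvectors. Every decomposition with $m\ge n$ elements has the form $|\chi_l\rangle=\sum_{k=1}^n \overline{U_{lk}}|\phi_k\rangle$ with $U$ an $m\times m$ unitary. Then $\rho\in\mathcal{D}$ if there is a unitary $U$ for which $\tau^\chi$ is a diagonal tensor (all entries vanish unless all indices are equal). For $\rho\in\mathcal{D}$ it is the paper's convention to replace the $\phi_k$ ($k=1,\dots,n$) by a decomposition for which the $\tau$-tensor is diagonal and, after absorbing phases, has non-negative diagonal entries $\lambda_k$. *)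

theory Defs
  imports "HOL-Analysis.Analysis"
begin

text \<open>
  The local dimension \<open>d\<close> is \<open>CARD('d)\<close>. A bipartite vector is a
  \<open>complex ^ ('d \<times> 'd)\<close>, whose component at \<open>(i, j)\<close> is its amplitude at the product
  basis vector \<open>|i>|j>\<close>. Finite families of vectors are indexed by \<open>{..<m}\<close>; values
  at other indices are irrelevant.
\<close>

type_synonym 'd bivec = "complex ^ ('d \<times> 'd)"
type_synonym 'd bimat = "complex ^ ('d \<times> 'd) ^ ('d \<times> 'd)"

text \<open>The inner product that the library puts on complex vectors is only the real part of this.\<close>

definition cinner :: "complex ^ 'n \<Rightarrow> complex ^ 'n \<Rightarrow> complex" where
  "cinner x y = (\<Sum>i\<in>UNIV. cnj (x $ i) * y $ i)"

definition dagger :: "complex ^ 'n ^ 'm \<Rightarrow> complex ^ 'm ^ 'n" where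
  "dagger A = map_matrix cnj (transpose A)"

definition ketbra :: "complex ^ 'n \<Rightarrow> complex ^ 'n ^ 'n" where
  "ketbra x = (\<chi> i j. x $ i * cnj (x $ j))"

definition density_operator :: "complex ^ 'n ^ 'n \<Rightarrow> bool" where
  "density_operator \<rho> \<longleftrightarrow>
     dagger \<rho> = \<rho> \<and> (\<forall>x. 0 \<le> Re (cinner x (\<rho> *v x))) \<and> trace \<rho> = 1"

definition coeff_matrix :: "'d bivec \<Rightarrow> complex ^ 'd ^ 'd" where
  "coeff_matrix \<phi> = (\<chi> i j. \<phi> $ (i, j))"

text \<open>
  The determinant of \<open>A\<^sup>\<dagger> A\<close> is a non-negative real number, so its real part loses nothing.
  Recall \<open>0 powr a = 0\<close>.
\<close>

definition G_concurrence :: "'d::finite bivec \<Rightarrow> real" where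
  "G_concurrence \<phi> =
     (let A = coeff_matrix \<phi>
      in real CARD('d) * (Re (det (dagger A ** A))) powr (1 / real CARD('d)))"

definition is_decomposition ::
    "complex ^ 'n ^ 'n \<Rightarrow> nat \<Rightarrow> (nat \<Rightarrow> complex ^ 'n) \<Rightarrow> bool" where
  "is_decomposition \<rho> m \<psi> \<longleftrightarrow>
     (\<forall>l<m. norm (\<psi> l) \<le> 1) \<and> \<rho> = (\<Sum>l<m. ketbra (\<psi> l))"

text \<open>
  \<open>GREATEST\<close> denotes an attained maximum; it is unspecified where no maximum exists.
\<close>

definition G_assistance :: "'d::finite bimat \<Rightarrow> real" where
  "G_assistance \<rho> =
     (GREATEST s. \<exists>m \<psi>. is_decomposition \<rho> m \<psi> \<and> s = (\<Sum>l<m. G_concurrence (\<psi> l)))"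

text \<open>
  The multi-index \<open>k_1 ... k_d\<close> is a function from \<open>'d\<close>. The conjugate is there because the
  entries \<open>a\<^sup>k\<^sub>i\<^sub>j\<close> of the tensor are the conjugated amplitudes of \<open>\<phi> k\<close>.
\<close>

definition tau :: "(nat \<Rightarrow> 'd::finite bivec) \<Rightarrow> ('d \<Rightarrow> nat) \<Rightarrow> complex" where
  "tau \<phi> k =
     complex_of_real (real CARD('d) powr (real CARD('d) / 2) / fact CARD('d)) *
     (\<Sum>\<sigma> | \<sigma> permutes (UNIV :: 'd set). det (\<chi> i j. cnj (\<phi> (k (\<sigma> i)) $ (i, j))))"

definition diagonal_tensor :: "nat \<Rightarrow> (('d \<Rightarrow> nat) \<Rightarrow> complex) \<Rightarrow> bool" where
  "diagonal_tensor m t \<longleftrightarrow>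
     (\<forall>k. (\<forall>i. k i < m) \<and> (\<exists>i j. k i \<noteq> k j) \<longrightarrow> t k = 0)"

definition eigen_decomposition ::
    "complex ^ 'n ^ 'n \<Rightarrow> nat \<Rightarrow> (nat \<Rightarrow> complex ^ 'n) \<Rightarrow> bool" where
  "eigen_decomposition \<rho> n \<phi> \<longleftrightarrow>
     is_decomposition \<rho> n \<phi> \<and>
     (\<forall>k<n. \<phi> k \<noteq> 0 \<and> (\<exists>e. \<rho> *v \<phi> k = e *s \<phi> k)) \<and>
     (\<forall>k<n. \<forall>l<n. k \<noteq> l \<longrightarrow> cinner (\<phi> k) (\<phi> l) = 0)"

definition unitary_upto :: "nat \<Rightarrow> (nat \<Rightarrow> nat \<Rightarrow> complex) \<Rightarrow> bool" where
  "unitary_upto m U \<longleftrightarrow>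
     (\<forall>k<m. \<forall>l<m. (\<Sum>j<m. U k j * cnj (U l j)) = (if k = l then 1 else 0)) \<and>
     (\<forall>k<m. \<forall>l<m. (\<Sum>j<m. cnj (U j k) * U j l) = (if k = l then 1 else 0))"

definition transform ::
    "nat \<Rightarrow> (nat \<Rightarrow> nat \<Rightarrow> complex) \<Rightarrow> (nat \<Rightarrow> complex ^ 'n) \<Rightarrow> nat \<Rightarrow> complex ^ 'n" where
  "transform n U \<phi> l = (\<Sum>k<n. cnj (U l k) *s \<phi> k)"

text \<open>
  If eigenvalues are degenerate, the eigen-decomposition is not unique. Two of them differ by an
  \<open>n \<times> n\<close> unitary, which can be absorbed into \<open>U\<close>, so membership does not depend on the choice.
\<close>

definition class_D :: "'d::finite bimat set" where
  "class_D = {\<rho>. density_operator \<rho> \<and>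
     (\<exists>\<phi> m U. eigen_decomposition \<rho> (rank \<rho>) \<phi> \<and> rank \<rho> \<le> m \<and> unitary_upto m U \<and>
        diagonal_tensor m (tau (transform (rank \<rho>) U \<phi>)))}"

end

theory Submission
  imports Defs
begin

text \<open>
  Multilinearity of the determinant, symmetrised over the multi-index, makes
  \<open>d\<^sup>d\<^sup>/\<^sup>2 Det\<close> of a superposition \<open>\<Sum>\<^sub>k c\<^sub>k \<phi>\<^sub>k\<close> the contraction of \<open>\<tau>\<close> with \<open>d\<close> copies of \<open>c\<close>.
  For a diagonal \<open>\<tau>\<close> only \<open>\<Sum>\<^sub>k c\<^sub>k\<^sup>d \<lambda>\<^sub>k\<close> survives, and since \<open>2/d \<le> 1\<close>, subadditivity of
  \<open>x\<^sup>2\<^sup>/\<^sup>d\<close> gives \<open>G \<le> \<Sum>\<^sub>k |c\<^sub>k|\<^sup>2 \<lambda>\<^sub>k\<^sup>2\<^sup>/\<^sup>d\<close>. The rank condition makes the \<open>\<phi>\<^sub>k\<close> linearly independent,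
  so the elements of any other decomposition are superpositions of the \<open>\<phi>\<^sub>k\<close> through a matrix with
  normalised columns; summing the bound over them yields \<open>\<Sum>\<^sub>k \<lambda>\<^sub>k\<^sup>2\<^sup>/\<^sup>d\<close>, which \<open>\<phi>\<close> itself attains.
\<close>

section \<open>Subadditivity of powers with exponent at most one\<close>

text \<open>A fraction \<open>t / s\<close> in [0, 1] only grows when raised to a power
  \<open>p\<close> \<le> 1. Splitting \<open>s powr p\<close> in the proportions
  \<open>x / s\<close> and \<open>y / s\<close> and bounding each share gives the claim.\<close>

lemma powr_add_subadditive:
  fixes x y p :: real
  assumes "0 \<le> x" "0 \<le> y" "0 < p" "p \<le> 1"
  shows "(x + y) powr p \<le> x powr p + y powr p"
proof (cases "x + y = 0")
  case True
  then show ?thesis using assms by simp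
next
  case False
  define s where "s = x + y"
  have s: "s > 0" using False assms(1,2) unfolding s_def by simp
  have frac: "t / s * s powr p \<le> t powr p" if "0 \<le> t" "t \<le> s" for t
  proof -
    have "(t / s) powr 1 \<le> (t / s) powr p"
      using that s assms by (intro powr_mono') auto
    then have "t / s * s powr p \<le> (t / s) powr p * s powr p"
      using that s by (intro mult_right_mono) auto
    also have "\<dots> = t powr p"
      using that s by (simp flip: powr_mult)
    finally show ?thesis .
  qed
  have "s powr p = x / s * s powr p + y / s * s powr p"
    using s by (simp add: s_def flip: distrib_right add_divide_distrib)
  also have "\<dots> \<le> x powr p + y powr p"
    using frac[of x] frac[of y] assms unfolding s_def by linarith
  finally show ?thesis unfolding s_def .
qed

lemma powr_sum_subadditive:
  fixes f :: "'a \<Rightarrow> real"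
  assumes "\<And>i. i \<in> A \<Longrightarrow> 0 \<le> f i" "0 < p" "p \<le> 1"
  shows "(\<Sum>i\<in>A. f i) powr p \<le> (\<Sum>i\<in>A. f i powr p)"
  using assms(1)
proof (induction A rule: infinite_finite_induct)
  case (insert a A)
  have "(f a + (\<Sum>i\<in>A. f i)) powr p \<le> f a powr p + (\<Sum>i\<in>A. f i) powr p"
    using insert.prems assms(2,3) by (intro powr_add_subadditive sum_nonneg) auto
  with insert show ?case by (smt (verit) insertCI sum.insert)
qed auto

section \<open>Multilinear expansion of the determinant\<close>

text \<open>The weight of \<open>k\<close> does not depend on the order of its entries, so composing
  with a permutation reindexes the sum and leaves the weights alone. Averaging over all d!
  permutations turns \<open>F\<close> into the symmetrised form that \<open>tau\<close> has.\<close>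

lemma sum_multi_index_symmetrize:
  fixes F :: "('d::finite \<Rightarrow> nat) \<Rightarrow> 'a::field_char_0"
  shows "(\<Sum>k | \<forall>i. k i < n. (\<Prod>i\<in>UNIV. u (k i)) * F k) =
    (\<Sum>k | \<forall>i. k i < n. (\<Prod>i\<in>UNIV. u (k i)) *
      ((\<Sum>\<sigma> | \<sigma> permutes (UNIV :: 'd set). F (k \<circ> \<sigma>)) / fact CARD('d)))"
    (is "?L = ?R")
proof -
  let ?K = "{k :: 'd \<Rightarrow> nat. \<forall>i. k i < n}"
  let ?P = "{\<sigma>. \<sigma> permutes (UNIV :: 'd set)}"
  have perm: "(\<Sum>k\<in>?K. (\<Prod>i\<in>UNIV. u (k i)) * F (k \<circ> \<sigma>)) = ?L" if \<sigma>: "\<sigma> \<in> ?P" for \<sigma>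
  proof (rule sum.reindex_bij_witness[where j = "\<lambda>k. k \<circ> \<sigma>" and i = "\<lambda>k. k \<circ> inv \<sigma>"])
    fix k assume "k \<in> ?K"
    have "(\<Prod>i\<in>UNIV. u ((k \<circ> \<sigma>) i)) = (\<Prod>i\<in>UNIV. u (k i))"
      using \<sigma> by (auto intro!: prod.reindex_bij_betw simp: o_def permutes_bij)
    then show "(\<Prod>i\<in>UNIV. u ((k \<circ> \<sigma>) i)) * F (k \<circ> \<sigma>) =
        (\<Prod>i\<in>UNIV. u (k i)) * F (k \<circ> \<sigma>)"
      by simp
  qed (use \<sigma> in \<open>auto simp: o_def fun_eq_iff permutes_inverses\<close>)
  have "?R = (\<Sum>k\<in>?K. \<Sum>\<sigma>\<in>?P. (\<Prod>i\<in>UNIV. u (k i)) * F (k \<circ> \<sigma>)) / fact CARD('d)"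
    by (simp add: sum_distrib_left sum_divide_distrib)
  also have "\<dots> = (\<Sum>\<sigma>\<in>?P. \<Sum>k\<in>?K. (\<Prod>i\<in>UNIV. u (k i)) * F (k \<circ> \<sigma>)) / fact CARD('d)"
    by (subst sum.swap) simp
  also have "\<dots> = (of_nat (card ?P) * ?L) / fact CARD('d)"
    by (simp add: perm)
  also have "\<dots> = ?L"
    by (simp add: card_permutations)
  finally show ?thesis by simp
qed

lemma det_rows_sum:
  fixes a :: "'d::finite \<Rightarrow> nat \<Rightarrow> 'a::comm_ring_1 ^ 'd"
  shows "det (\<chi> i. \<Sum>k<n. a i k) = (\<Sum>k | \<forall>i. k i < n. det (\<chi> i. a i (k i)))"
proof -
  have PiE: "PiE UNIV (\<lambda>_ :: 'd. {..<n}) = {k. \<forall>i. k i < n}"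
    by (auto simp: PiE_def)
  have "det (\<chi> i. \<Sum>k<n. a i k) =
      (\<Sum>p | p permutes (UNIV :: 'd set). \<Sum>k | \<forall>i. k i < n.
        of_int (sign p) * (\<Prod>i\<in>UNIV. a i (k i) $ p i))"
    by (simp add: det_def prod_sum_PiE PiE sum_distrib_left)
  also have "\<dots> = (\<Sum>k | \<forall>i. k i < n. det (\<chi> i. a i (k i)))"
    by (subst sum.swap) (simp add: det_def)
  finally show ?thesis .
qed

text \<open>Row \<open>i\<close> of the matrix is the combination of the i-th rows of the
  \<open>\<phi> k\<close> with weights \<open>cnj (c k)\<close>, so the determinant expands over
  multi-indices. Its weights are symmetric, which lets symmetrisation produce
  \<open>tau\<close>.\<close>

lemma det_cnj_superposition:
  fixes \<phi> :: "nat \<Rightarrow> 'd::finite bivec"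
  shows "complex_of_real (real CARD('d) powr (real CARD('d) / 2)) *
      det (\<chi> i j. cnj ((\<Sum>k<n. c k *s \<phi> k) $ (i, j)) :: complex ^ 'd ^ 'd) =
    (\<Sum>k | \<forall>i. k i < n. (\<Prod>i\<in>UNIV. cnj (c (k i))) * tau \<phi> k)"
proof -
  let ?D = "complex_of_real (real CARD('d) powr (real CARD('d) / 2))"
  let ?F = "\<lambda>k :: 'd \<Rightarrow> nat. det (\<chi> i j. cnj (\<phi> (k i) $ (i, j)) :: complex ^ 'd ^ 'd)"
  have "(\<chi> i j. cnj ((\<Sum>k<n. c k *s \<phi> k) $ (i, j)) :: complex ^ 'd ^ 'd) =
      (\<chi> i. \<Sum>k<n. cnj (c k) *s (\<chi> j. cnj (\<phi> k $ (i, j))))"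
    by (simp add: vec_eq_iff)
  then have "det (\<chi> i j. cnj ((\<Sum>k<n. c k *s \<phi> k) $ (i, j)) :: complex ^ 'd ^ 'd) =
      (\<Sum>k | \<forall>i. k i < n. det (\<chi> i. cnj (c (k i)) *s (\<chi> j. cnj (\<phi> (k i) $ (i, j))) :: complex ^ 'd ^ 'd))"
    by (simp only: det_rows_sum)
  also have "\<dots> = (\<Sum>k | \<forall>i. k i < n. (\<Prod>i\<in>UNIV. cnj (c (k i))) * ?F k)"
    by (simp add: det_rows_mul)
  also have "\<dots> = (\<Sum>k | \<forall>i. k i < n. (\<Prod>i\<in>UNIV. cnj (c (k i))) *
      ((\<Sum>\<sigma> | \<sigma> permutes (UNIV :: 'd set). ?F (k \<circ> \<sigma>)) / fact CARD('d)))"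
    by (rule sum_multi_index_symmetrize)
  finally have "?D * det (\<chi> i j. cnj ((\<Sum>k<n. c k *s \<phi> k) $ (i, j)) :: complex ^ 'd ^ 'd) =
      ?D * (\<Sum>k | \<forall>i. k i < n. (\<Prod>i\<in>UNIV. cnj (c (k i))) *
        ((\<Sum>\<sigma> | \<sigma> permutes (UNIV :: 'd set). ?F (k \<circ> \<sigma>)) / fact CARD('d)))"
    by (rule arg_cong)
  also have "\<dots> = (\<Sum>k | \<forall>i. k i < n. ?D * ((\<Prod>i\<in>UNIV. cnj (c (k i))) *
        ((\<Sum>\<sigma> | \<sigma> permutes (UNIV :: 'd set). ?F (k \<circ> \<sigma>)) / fact CARD('d))))"
    by (rule sum_distrib_left)
  also have "\<dots> = (\<Sum>k | \<forall>i. k i < n. (\<Prod>i\<in>UNIV. cnj (c (k i))) * tau \<phi> k)"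
    by (intro sum.cong refl) (simp add: tau_def)
  finally show ?thesis .
qed

section \<open>G-concurrence in terms of the tensor\<close>

text \<open>The prefactor is d = (d^(d/2))^(2/d), and the determinant of
  \<open>dagger A ** A\<close> is the squared modulus of \<open>det A\<close>; conjugating the
  entries keeps that modulus. The normalisation now matches that of \<open>tau\<close>.\<close>

lemma G_concurrence_altdef:
  fixes \<psi> :: "'d::finite bivec"
  shows "G_concurrence \<psi> =
    cmod (complex_of_real (real CARD('d) powr (real CARD('d) / 2)) *
      det (\<chi> i j. cnj (\<psi> $ (i, j)) :: complex ^ 'd ^ 'd)) powr (2 / real CARD('d))"
proof -
  let ?d = "real CARD('d)" and ?A = "coeff_matrix \<psi>"
  have map_cnj: "det (\<chi> i j. cnj (B $ i $ j) :: complex ^ 'd ^ 'd) = cnj (det B)" for B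
    by (simp add: det_def)
  have cdet: "det (\<chi> i j. cnj (\<psi> $ (i, j)) :: complex ^ 'd ^ 'd) = cnj (det ?A)"
    using map_cnj[of ?A] by (simp add: coeff_matrix_def)
  have "dagger ?A = (\<chi> i j. cnj (transpose ?A $ i $ j))"
    by (simp add: dagger_def map_matrix_def)
  then have "det (dagger ?A) = cnj (det ?A)"
    by (simp add: map_cnj det_transpose del: transpose_def)
  then have "det (dagger ?A ** ?A) = complex_of_real ((cmod (det ?A))\<^sup>2)"
    by (simp add: det_mul complex_norm_square mult.commute del: of_real_power)
  then have "G_concurrence \<psi> = ?d * ((cmod (det ?A))\<^sup>2) powr (1 / ?d)"
    by (simp add: G_concurrence_def Let_def del: of_real_power)
  also have "((cmod (det ?A))\<^sup>2) powr (1 / ?d) = cmod (det ?A) powr (2 / ?d)"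
  proof (cases "det ?A = 0")
    case False
    then have "(cmod (det ?A))\<^sup>2 = cmod (det ?A) powr 2" by simp
    then show ?thesis by (simp only: powr_powr) simp
  qed simp
  also have "?d = (?d powr (?d / 2)) powr (2 / ?d)"
    by (simp add: powr_powr)
  finally have "G_concurrence \<psi> = (?d powr (?d / 2)) powr (2 / ?d) * cmod (det ?A) powr (2 / ?d)" 
    by (simp add: powr_powr)
  then show ?thesis
    by (simp add: cdet norm_mult powr_mult)
qed

text \<open>At a constant multi-index all d! summands of \<open>tau\<close> coincide and cancel the
  factorial.\<close>

lemma G_concurrence_eq_tau:
  fixes \<phi> :: "nat \<Rightarrow> 'd::finite bivec"
  shows "G_concurrence (\<phi> k) = cmod (tau \<phi> (\<lambda>_. k)) powr (2 / real CARD('d))"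
  by (simp add: G_concurrence_altdef tau_def card_permutations)

lemma G_concurrence_superposition_le:
  fixes \<phi> :: "nat \<Rightarrow> 'd::finite bivec"
  assumes d: "CARD('d) \<ge> 2"
    and diag: "diagonal_tensor n (tau \<phi>)"
    and tau: "\<And>k. k < n \<Longrightarrow> cmod (tau \<phi> (\<lambda>_. k)) = lam k"
  shows "G_concurrence (\<Sum>k<n. c k *s \<phi> k) \<le>
    (\<Sum>k<n. (cmod (c k))\<^sup>2 * lam k powr (2 / real CARD('d)))"
proof -
  let ?d = "CARD('d)"
  have "(\<Sum>k | \<forall>i. k i < n. (\<Prod>i\<in>UNIV. cnj (c (k i))) * tau \<phi> k) =
      (\<Sum>k \<in> (\<lambda>k (_ :: 'd). k) ` {..<n}. (\<Prod>i\<in>UNIV. cnj (c (k i))) * tau \<phi> k)"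
  proof (rule sum.mono_neutral_right)
    have "{k :: 'd \<Rightarrow> nat. \<forall>i. k i < n} = PiE UNIV (\<lambda>_. {..<n})"
      by (auto simp: PiE_def)
    then show "finite {k :: 'd \<Rightarrow> nat. \<forall>i. k i < n}"
      by (simp add: finite_PiE)
    show "\<forall>k \<in> {k. \<forall>i. k i < n} - (\<lambda>k (_ :: 'd). k) ` {..<n}.
        (\<Prod>i\<in>UNIV. cnj (c (k i))) * tau \<phi> k = 0"
    proof
      fix k :: "'d \<Rightarrow> nat"
      assume k: "k \<in> {k. \<forall>i. k i < n} - (\<lambda>k _. k) ` {..<n}"
      have "\<exists>i j. k i \<noteq> k j"
      proof (rule ccontr)
        assume "\<nexists>i j. k i \<noteq> k j"
        then have "k = (\<lambda>_. k undefined)" by (intro ext) blast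
        moreover have "k undefined < n" using k by simp
        ultimately show False using k by blast
      qed
      with k diag show "(\<Prod>i\<in>UNIV. cnj (c (k i))) * tau \<phi> k = 0"
        unfolding diagonal_tensor_def by auto
    qed
  qed auto
  also have "\<dots> = (\<Sum>k<n. cnj (c k) ^ ?d * tau \<phi> (\<lambda>_. k))"
    by (subst sum.reindex) (auto simp: inj_on_def fun_eq_iff)
  finally have "G_concurrence (\<Sum>k<n. c k *s \<phi> k) =
      cmod (\<Sum>k<n. cnj (c k) ^ ?d * tau \<phi> (\<lambda>_. k)) powr (2 / ?d)"
    by (simp only: G_concurrence_altdef det_cnj_superposition)
  also have "\<dots> \<le> (\<Sum>k<n. cmod (c k) ^ ?d * lam k) powr (2 / ?d)"
    by (intro powr_mono2 sum_norm_le) (auto simp: norm_mult norm_power tau)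
  also have "\<dots> \<le> (\<Sum>k<n. (cmod (c k) ^ ?d * lam k) powr (2 / ?d))"
  \<comment> \<open>Here d \<ge> 2 makes the exponent 2/d at most 1.\<close>
  proof (rule powr_sum_subadditive)
    show "0 \<le> cmod (c k) ^ ?d * lam k" if "k \<in> {..<n}" for k
      using that by (simp flip: tau)
  qed (use d in auto)
  also have "\<dots> = (\<Sum>k<n. (cmod (c k))\<^sup>2 * lam k powr (2 / ?d))"
  proof (rule sum.cong)
    fix k assume "k \<in> {..<n}"
    have "(cmod (c k) ^ ?d) powr (2 / ?d) = (cmod (c k))\<^sup>2"
    proof (cases "c k = 0")
      case False
      then have "cmod (c k) ^ ?d = cmod (c k) powr ?d" by (simp add: powr_realpow)
      with False show ?thesis by (simp add: powr_powr powr_numeral)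
    qed (use d in simp)
    then show "(cmod (c k) ^ ?d * lam k) powr (2 / ?d) = (cmod (c k))\<^sup>2 * lam k powr (2 / ?d)"
      using \<open>k \<in> {..<n}\<close> by (simp add: powr_mult flip: tau)
  qed simp
  finally show ?thesis .
qed

section \<open>Comparing two decompositions of one operator\<close>

text \<open>The right-hand side is the quadratic form of the operator at \<open>x\<close>. Hence the
  sum on the left is the same for every decomposition of that operator.\<close>

lemma cmod_cinner_sum_ketbra:
  fixes x :: "complex ^ 'n::finite"
  shows "complex_of_real (\<Sum>k\<in>K. (cmod (cinner x (\<phi> k)))\<^sup>2) =
    (\<Sum>i\<in>UNIV. \<Sum>j\<in>UNIV. cnj (x $ i) * (\<Sum>k\<in>K. ketbra (\<phi> k)) $ i $ j * x $ j)"
proof -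
  have "complex_of_real (\<Sum>k\<in>K. (cmod (cinner x (\<phi> k)))\<^sup>2) =
      (\<Sum>k\<in>K. \<Sum>i\<in>UNIV. \<Sum>j\<in>UNIV. cnj (x $ i) * ketbra (\<phi> k) $ i $ j * x $ j)"
    unfolding of_real_sum complex_norm_square
  proof (rule sum.cong)
    fix k
    have "cinner x (\<phi> k) * cnj (cinner x (\<phi> k)) =
        (\<Sum>i\<in>UNIV. \<Sum>j\<in>UNIV. (cnj (x $ i) * \<phi> k $ i) * (x $ j * cnj (\<phi> k $ j)))"
      by (simp add: cinner_def sum_product)
    then show "cinner x (\<phi> k) * cnj (cinner x (\<phi> k)) =
        (\<Sum>i\<in>UNIV. \<Sum>j\<in>UNIV. cnj (x $ i) * ketbra (\<phi> k) $ i $ j * x $ j)"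
      by (simp add: ketbra_def mult_ac)
  qed simp
  also have "\<dots> = (\<Sum>i\<in>UNIV. \<Sum>k\<in>K. \<Sum>j\<in>UNIV. cnj (x $ i) * ketbra (\<phi> k) $ i $ j * x $ j)"
    by (rule sum.swap)
  also have "\<dots> = (\<Sum>i\<in>UNIV. \<Sum>j\<in>UNIV. \<Sum>k\<in>K. cnj (x $ i) * ketbra (\<phi> k) $ i $ j * x $ j)"
    by (intro sum.cong refl sum.swap)
  finally show ?thesis
    by (simp add: sum_distrib_left sum_distrib_right)
qed

text \<open>The rows of the operator lie in the span of the \<open>n\<close> conjugated vectors, so
  rank \<open>n\<close> forces these to be distinct and independent. The coordinate functionals on
  them then supply the dual vectors.\<close>

lemma dual_family_of_rank:
  fixes \<phi> :: "nat \<Rightarrow> complex ^ 'n::finite"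
  assumes "rank (\<Sum>k<n. ketbra (\<phi> k)) = n"
  obtains w where "\<And>k l. k < n \<Longrightarrow> l < n \<Longrightarrow> cinner (w k) (\<phi> l) = (if k = l then 1 else 0)"
proof -
  define \<psi> where "\<psi> k = (\<chi> j. cnj (\<phi> k $ j))" for k
  let ?B = "\<psi> ` {..<n}"
  have "row i (\<Sum>k<n. ketbra (\<phi> k)) = (\<Sum>k<n. \<phi> k $ i *s \<psi> k)" for i
    by (simp add: vec_eq_iff row_def ketbra_def \<psi>_def)
  then have "rows (\<Sum>k<n. ketbra (\<phi> k)) \<subseteq> vec.span ?B"
    unfolding rows_def by (auto intro!: vec.span_sum vec.span_scale intro: vec.span_base)
  then have n: "n \<le> vec.dim (vec.span ?B)"
    using vec.dim_mono assms unfolding row_rank_def_gen by (metis vec.dim_span)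
  then have "n \<le> card ?B"
    using vec.dim_le_card'[of ?B] by simp
  then have inj: "inj_on \<psi> {..<n}"
    by (metis card_image_le card_lessThan eq_card_imp_inj_on finite_lessThan le_antisym)
  have indep: "vec.independent ?B"
    using n card_image_le[of "{..<n}" \<psi>]
    by (intro vec.card_le_dim_spanning[of ?B "vec.span ?B"]) (auto simp: vec.span_superset)
  have "\<exists>v. \<forall>l<n. cinner v (\<phi> l) = (if k = l then 1 else 0)" if "k < n" for k
  proof -
    \<comment> \<open>A functional is taken as a map into \<open>complex ^ 1\<close>, so that the
      single row of its matrix is the required vector.\<close>
    obtain g :: "complex ^ 'n \<Rightarrow> complex ^ 1" where g: "Vector_Spaces.linear (*s) (*s) g"
      "\<forall>x\<in>?B. g x = (if x = \<psi> k then 1 else 0)"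
      using vec.linear_independent_extend[OF indep, of "\<lambda>x. if x = \<psi> k then 1 else 0"] by blast
    define v where "v = matrix g $ 1"
    have "cinner v (\<phi> l) = (if k = l then 1 else 0)" if "l < n" for l
    proof -
      have "cinner v (\<phi> l) = cnj ((matrix g *v \<psi> l) $ 1)"
        by (simp add: cinner_def v_def \<psi>_def matrix_vector_mult_def)
      also have "\<dots> = (if k = l then 1 else 0)"
        using g that \<open>k < n\<close> inj by (auto simp: matrix_works inj_on_def)
      finally show ?thesis .
    qed
    then show ?thesis by blast
  qed
  then obtain w where "\<forall>k<n. \<forall>l<n. cinner (w k) (\<phi> l) = (if k = l then 1 else 0)"
    by metis
  then show ?thesis using that by blast
qed

text \<open>The coefficients are pairings with the dual family \<open>w\<close>. Both claims test
  the common quadratic form: it vanishes at vectors orthogonal to all \<open>\<phi> k\<close>, which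
  kills the residual of each \<open>\<psi> l\<close>, and it equals 1 at \<open>w k\<close>, which
  normalises the columns.\<close>

lemma decomposition_superposition:
  fixes \<phi> \<psi> :: "nat \<Rightarrow> complex ^ 'n::finite"
  assumes rank: "rank (\<Sum>k<n. ketbra (\<phi> k)) = n"
    and eq: "(\<Sum>l<m. ketbra (\<psi> l)) = (\<Sum>k<n. ketbra (\<phi> k))"
  obtains c where "\<And>l. l < m \<Longrightarrow> \<psi> l = (\<Sum>k<n. c l k *s \<phi> k)"
    and "\<And>k. k < n \<Longrightarrow> (\<Sum>l<m. (cmod (c l k))\<^sup>2) = 1"
proof -
  obtain w where w: "\<And>k l. k < n \<Longrightarrow> l < n \<Longrightarrow> cinner (w k) (\<phi> l) = (if k = l then 1 else 0)"
    using dual_family_of_rank[OF rank] by blast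
  have expect: "(\<Sum>l<m. (cmod (cinner x (\<psi> l)))\<^sup>2) = (\<Sum>k<n. (cmod (cinner x (\<phi> k)))\<^sup>2)" for x
  proof -
    have "complex_of_real (\<Sum>l<m. (cmod (cinner x (\<psi> l)))\<^sup>2) =
        complex_of_real (\<Sum>k<n. (cmod (cinner x (\<phi> k)))\<^sup>2)"
      unfolding cmod_cinner_sum_ketbra eq ..
    then show ?thesis
      by (simp only: of_real_eq_iff)
  qed
  have "\<psi> l = (\<Sum>k<n. cinner (w k) (\<psi> l) *s \<phi> k)" if l: "l < m" for l
  proof (subst vec_eq_iff, intro allI)
    fix i
    \<comment> \<open>\<open>\<langle>x, v\<rangle>\<close> is the \<open>i\<close>-th component of the residual of \<open>v\<close> after projection onto the span of \<open>\<phi>\<close>.\<close>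
    define x where "x = axis i 1 - (\<Sum>k<n. cnj (\<phi> k $ i) *s w k)"
    have x: "cinner x v = v $ i - (\<Sum>k<n. \<phi> k $ i * cinner (w k) v)" for v
    proof -
      have "cinner x v = (\<Sum>j\<in>UNIV. cnj (axis i 1 $ j) * v $ j) -
          (\<Sum>j\<in>UNIV. \<Sum>k<n. \<phi> k $ i * (cnj (w k $ j) * v $ j))"
        by (simp add: cinner_def x_def left_diff_distrib sum_subtractf sum_distrib_right mult.assoc)
      also have "(\<Sum>j\<in>UNIV. cnj (axis i 1 $ j) * v $ j) = v $ i"
        by (simp add: axis_def if_distrib[of cnj] if_distrib[of "\<lambda>a. a * _"] cong: if_cong)
      finally show ?thesis
        by (subst (asm) sum.swap) (simp add: cinner_def sum_distrib_left)
    qed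
    have "cinner x (\<phi> k) = 0" if "k < n" for k
      using that by (simp add: x w if_distrib[of "\<lambda>a. _ * a"] cong: if_cong)
    then have "(\<Sum>l<m. (cmod (cinner x (\<psi> l)))\<^sup>2) = 0"
      by (simp add: expect)
    with l have "cinner x (\<psi> l) = 0"
      by (simp add: sum_nonneg_eq_0_iff)
    then show "\<psi> l $ i = (\<Sum>k<n. cinner (w k) (\<psi> l) *s \<phi> k) $ i"
      by (simp add: x mult.commute)
  qed
  moreover have "(\<Sum>l<m. (cmod (cinner (w k) (\<psi> l)))\<^sup>2) = 1" if "k < n" for k
    using that by (simp add: expect w if_distrib[of cmod] if_distrib[of "\<lambda>a. a\<^sup>2"] cong: if_cong)
  ultimately show ?thesis by (rule that)
qed

theorem theorem4:
  fixes \<rho> :: "complex ^ ('d::finite \<times> 'd) ^ ('d \<times> 'd)"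
    and n :: nat
    and \<phi> :: "nat \<Rightarrow> complex ^ ('d \<times> 'd)"
    and lam :: "nat \<Rightarrow> real"
  assumes "CARD('d) \<ge> 2"
    and "density_operator \<rho>"
    and "rank \<rho> = n"
    and "\<rho> \<in> class_D"
    and "is_decomposition \<rho> n \<phi>"
    and "diagonal_tensor n (tau \<phi>)"
    and "\<And>k. k < n \<Longrightarrow> tau \<phi> (\<lambda>_. k) = complex_of_real (lam k)"
    and "\<And>k. k < n \<Longrightarrow> 0 \<le> lam k"
  shows "G_assistance \<rho> = (\<Sum>k<n. lam k powr (2 / real CARD('d)))"
  unfolding G_assistance_def
proof (rule Greatest_equality)
  have lam: "cmod (tau \<phi> (\<lambda>_. k)) = lam k" if "k < n" for k
    using assms(7,8)[OF that] by simp
  show "\<exists>m \<psi>. is_decomposition \<rho> m \<psi> \<and>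
      (\<Sum>k<n. lam k powr (2 / real CARD('d))) = (\<Sum>l<m. G_concurrence (\<psi> l))"
    \<comment> \<open>The maximum is attained at \<open>\<phi>\<close> itself, each of whose
      elements contributes one summand.\<close>
    using assms(5) by (intro exI[of _ n] exI[of _ \<phi>]) (simp add: G_concurrence_eq_tau lam)
  fix s
  assume "\<exists>m \<psi>. is_decomposition \<rho> m \<psi> \<and> s = (\<Sum>l<m. G_concurrence (\<psi> l))"
  then obtain m \<psi> where \<psi>: "is_decomposition \<rho> m \<psi>" and s: "s = (\<Sum>l<m. G_concurrence (\<psi> l))"
    by blast
  have \<rho>: "\<rho> = (\<Sum>k<n. ketbra (\<phi> k))" "\<rho> = (\<Sum>l<m. ketbra (\<psi> l))"
    using assms(5) \<psi> by (auto simp: is_decomposition_def)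
  obtain c where c: "\<And>l. l < m \<Longrightarrow> \<psi> l = (\<Sum>k<n. c l k *s \<phi> k)"
    and col: "\<And>k. k < n \<Longrightarrow> (\<Sum>l<m. (cmod (c l k))\<^sup>2) = 1"
  proof (rule decomposition_superposition[of \<phi> n \<psi> m])
    show "rank (\<Sum>k<n. ketbra (\<phi> k)) = n"
      using assms(3) \<rho>(1) by simp
    show "(\<Sum>l<m. ketbra (\<psi> l)) = (\<Sum>k<n. ketbra (\<phi> k))"
      using \<rho> by simp
  qed blast
  have "s \<le> (\<Sum>l<m. \<Sum>k<n. (cmod (c l k))\<^sup>2 * lam k powr (2 / real CARD('d)))"
    unfolding s using G_concurrence_superposition_le[OF assms(1,6) lam]
    by (intro sum_mono) (simp add: c)
  \<comment> \<open>Exchanging the sums isolates the squared column norms of \<open>c\<close>, all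
    equal to 1.\<close>
  also have "\<dots> = (\<Sum>k<n. (\<Sum>l<m. (cmod (c l k))\<^sup>2) * lam k powr (2 / real CARD('d)))"
    by (subst sum.swap) (simp add: sum_distrib_right)
  finally show "s \<le> (\<Sum>k<n. lam k powr (2 / real CARD('d)))"
    by (simp add: col)
qed

end
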